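(* There are hypergraph families $\mathcal{H}$ with $\rho^\ast(\mathcal{H})<\infty$ such that there is a polynomial-time reduction from the Graph Isomorphism problem to $\#\textsc{IndSub}(\mathcal{H})$.
   Context: A hypergraph is a pair $H=(V,E)$ with $V$ finite and $E\subseteq2^V\setminus\{\varnothing\}$. For $X\subseteq V(G)$, $G[X]=(X,\{e\in E(G):e\subseteq X\})$. $\#\textsc{IndSub}(\mathcal{H})$: given $H\in\mathcal{H}$ and a hypergraph $G$, output the number of induced sub-hypergraphs of $G$ isomorphic to $H$. For this invariant each isolated vertex $v$ is placed into an extra edge $\{v\}$; $\rho^\ast(H)$ is the minimum of $\sum_e\xi(e)$ over $\xi:E\to\mathbb{R}_{\ge0}$ with $\sum_{e\ni v}\xi(e)\ge1$ for all $v\in V$, and $\rho^\ast(\mathcal{H}):=\sup_{H\in\mathcal{H}}\rho^\ast(H)$. Graph Isomorphism: given two graphs, decide whether they are isomorphic. *)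

theory Defs
  imports
    "HOL-Library.Extended_Real"
    "HOL-Computational_Algebra.Polynomial"
begin

section \<open>Hypergraphs\<close>

type_synonym 'a hypergraph = "'a set \<times> 'a set set"

abbreviation verts :: "'a hypergraph \<Rightarrow> 'a set" where "verts \<equiv> fst"
abbreviation edges :: "'a hypergraph \<Rightarrow> 'a set set" where "edges \<equiv> snd"

definition hypergraph :: "'a hypergraph \<Rightarrow> bool" where
  "hypergraph H \<longleftrightarrow> finite (verts H) \<and> edges H \<subseteq> Pow (verts H) - {{}}"

definition graph :: "'a hypergraph \<Rightarrow> bool" where
  "graph G \<longleftrightarrow> hypergraph G \<and> (\<forall>e\<in>edges G. card e = 2)"

definition isomorphic :: "'a hypergraph \<Rightarrow> 'b hypergraph \<Rightarrow> bool" where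
  "isomorphic G H \<longleftrightarrow>
     (\<exists>f. bij_betw f (verts G) (verts H) \<and> (\<lambda>e. f ` e) ` edges G = edges H)"

definition induced :: "'a hypergraph \<Rightarrow> 'a set \<Rightarrow> 'a hypergraph" where
  "induced G X = (X, {e \<in> edges G. e \<subseteq> X})"

definition count_ind_sub :: "'a hypergraph \<Rightarrow> 'b hypergraph \<Rightarrow> nat" where
  "count_ind_sub H G = card {F. (\<exists>X \<subseteq> verts G. F = induced G X) \<and> isomorphic F H}"

text \<open>Fractional edge covers are taken after every vertex lying in no edge
  has been put into an extra singleton edge.\<close>

definition cover_edges :: "'a hypergraph \<Rightarrow> 'a set set" where
  "cover_edges H = edges H \<union> {{v} | v. v \<in> verts H \<and> (\<forall>e\<in>edges H. v \<notin> e)}"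

definition fractional_edge_cover :: "'a hypergraph \<Rightarrow> ('a set \<Rightarrow> real) \<Rightarrow> bool" where
  "fractional_edge_cover H \<xi> \<longleftrightarrow>
     (\<forall>e\<in>cover_edges H. 0 \<le> \<xi> e) \<and>
     (\<forall>v\<in>verts H. 1 \<le> (\<Sum>e \<in> {e \<in> cover_edges H. v \<in> e}. \<xi> e))"

text \<open>The minimum of this linear program is attained, so it is the infimum.\<close>

definition rho_star :: "'a hypergraph \<Rightarrow> real" where
  "rho_star H = Inf {\<Sum>e\<in>cover_edges H. \<xi> e | \<xi>. fractional_edge_cover H \<xi>}"

definition rho_star_family :: "'a hypergraph set \<Rightarrow> ereal" where
  "rho_star_family \<H> = (SUP H\<in>\<H>. ereal (rho_star H))"


section \<open>Encodings\<close>

datatype letter = Zero | One | Comma | Semicolon | Hash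

type_synonym word = "letter list"

text \<open>Binary, least significant bit first; 0 is encoded by the empty word.\<close>

fun bits :: "nat \<Rightarrow> word" where
  "bits n = (if n = 0 then [] else (if odd n then One else Zero) # bits (n div 2))"

declare bits.simps [simp del]

definition enc_vertex_list :: "nat list \<Rightarrow> word" where
  "enc_vertex_list vs = concat (map (\<lambda>v. bits v @ [Comma]) vs) @ [Semicolon]"

definition enc_hypergraph :: "nat list \<Rightarrow> nat list list \<Rightarrow> word" where
  "enc_hypergraph vs es = enc_vertex_list vs @ concat (map enc_vertex_list es) @ [Hash]"

text \<open>A hypergraph has one encoding for each order of listing its vertices, its edges,
  and the vertices of each edge.\<close>

definition encodes :: "word \<Rightarrow> nat hypergraph \<Rightarrow> bool" where
  "encodes w H \<longleftrightarrow>
     (\<exists>vs es. w = enc_hypergraph vs es \<and>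
        distinct vs \<and> set vs = verts H \<and>
        (\<forall>e\<in>set es. distinct e) \<and> distinct (map set es) \<and> set (map set es) = edges H)"


section \<open>Problems\<close>

text \<open>A problem is the set of pairs of an encoded instance and its answer; nothing is required
  on words that encode no instance.\<close>

type_synonym decision_problem = "(word \<times> bool) set"
type_synonym function_problem = "(word \<times> word) set"

definition graph_isomorphism :: decision_problem where
  "graph_isomorphism =
     {(u @ v, isomorphic G G') | u v G G'.
        graph G \<and> graph G' \<and> encodes u G \<and> encodes v G'}"

definition num_ind_sub :: "nat hypergraph set \<Rightarrow> function_problem" where
  "num_ind_sub \<H> =
     {(u @ v, bits (count_ind_sub H G)) | u v H G.
        H \<in> \<H> \<and> hypergraph G \<and> encodes u H \<and> encodes v G}"


section \<open>Oracle Turing machines\<close>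

text \<open>Deterministic machines with finitely many two-way infinite tapes. Tape 0 initially
  contains the input and tape 1 is the oracle tape. The states are the numbers below
  \<open>num_states\<close>; the tape alphabet consists of the blank, all letters, and
  \<open>num_aux\<close> auxiliary symbols. The moves -1, 0, 1 are left, stay, right.\<close>

datatype symbol = Blank | Letter letter | Aux nat

record machine =
  num_states :: nat
  num_aux :: nat
  num_tapes :: nat
  start_state :: nat
  query_state :: nat
  resume_state :: nat
  accept_state :: nat
  reject_state :: nat
  transition :: "nat \<Rightarrow> symbol list \<Rightarrow> nat \<times> (symbol \<times> int) list"

definition tape_alphabet :: "machine \<Rightarrow> symbol set" where
  "tape_alphabet M = {Blank} \<union> range Letter \<union> Aux ` {..<num_aux M}"

definition oracle_machine :: "machine \<Rightarrow> bool" where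
  "oracle_machine M \<longleftrightarrow>
     2 \<le> num_tapes M \<and>
     {start_state M, query_state M, resume_state M, accept_state M, reject_state M}
       \<subseteq> {..<num_states M} \<and>
     distinct [query_state M, accept_state M, reject_state M] \<and>
     (\<forall>q < num_states M. \<forall>ss. length ss = num_tapes M \<and> set ss \<subseteq> tape_alphabet M \<longrightarrow>
        (case transition M q ss of (q', acts) \<Rightarrow>
           q' < num_states M \<and> length acts = num_tapes M \<and>
           set acts \<subseteq> tape_alphabet M \<times> {-1, 0, 1}))"

type_synonym tape = "(int \<Rightarrow> symbol) \<times> int"
type_synonym config = "nat \<times> tape list"

definition tape_of :: "word \<Rightarrow> tape" where
  "tape_of w =
     ((\<lambda>i. if 0 \<le> i \<and> i < int (length w) then Letter (w ! nat i) else Blank), 0)"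

text \<open>The maximal word of letters starting at cell 0.\<close>

definition word_on :: "tape \<Rightarrow> word" where
  "word_on T =
     (let n = (LEAST n. fst T (int n) \<notin> range Letter)
      in map (\<lambda>i. the_inv Letter (fst T (int i))) [0..<n])"

definition initial :: "machine \<Rightarrow> word \<Rightarrow> config" where
  "initial M w = (start_state M, tape_of w # replicate (num_tapes M - 1) (tape_of []))"

text \<open>A query replaces the whole oracle tape by the answer and costs one step.\<close>

fun step :: "(word \<Rightarrow> word) \<Rightarrow> machine \<Rightarrow> config \<Rightarrow> config" where
  "step \<O> M (q, Ts) =
     (if q = accept_state M \<or> q = reject_state M then (q, Ts)
      else if q = query_state M then (resume_state M, Ts[1 := tape_of (\<O> (word_on (Ts ! 1)))])
      else (case transition M q (map (\<lambda>(t, h). t h) Ts) of (q', acts) \<Rightarrow>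
              (q', map2 (\<lambda>(t, h) (s, d). (t(h := s), h + d)) Ts acts)))"

definition decides_within ::
    "(word \<Rightarrow> word) \<Rightarrow> machine \<Rightarrow> word \<Rightarrow> bool \<Rightarrow> nat \<Rightarrow> bool" where
  "decides_within \<O> M w b n \<longleftrightarrow>
     fst ((step \<O> M ^^ n) (initial M w)) = (if b then accept_state M else reject_state M)"

text \<open>Polynomial-time Turing reductions. The machine has to work with every oracle that answers
  the instances of the target problem correctly, whatever it answers on other words.\<close>

definition solves :: "(word \<Rightarrow> word) \<Rightarrow> function_problem \<Rightarrow> bool" where
  "solves \<O> P \<longleftrightarrow> (\<forall>(x, y) \<in> P. \<O> x = y)"

definition poly_time_reducible :: "decision_problem \<Rightarrow> function_problem \<Rightarrow> bool" where
  "poly_time_reducible D P \<longleftrightarrow>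
     (\<exists>M (p :: nat poly). oracle_machine M \<and>
        (\<forall>\<O>. solves \<O> P \<longrightarrow>
           (\<forall>(w, b) \<in> D. decides_within \<O> M w b (poly p (length w)))))"


section \<open>Encodings are unambiguous\<close>

text \<open>Hence an oracle solving \<open>num_ind_sub \<H>\<close> exists, and a reduction to it is not vacuous.\<close>

lemma set_bits: "set (bits n) \<subseteq> {Zero, One}"
proof (induction n rule: bits.induct)
  case (1 n)
  then show ?case using bits.simps[of n] by (cases "n = 0") auto
qed

lemma bits_inj: "bits m = bits n \<Longrightarrow> m = n"
proof (induction m arbitrary: n rule: bits.induct)
  case (1 m)
  show ?case
  proof (cases "m = 0 \<or> n = 0")
    case True
    with "1.prems" show ?thesis
      using bits.simps[of m] bits.simps[of n] by (simp split: if_splits)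
  next
    case False
    have eq: "(if odd m then One else Zero) # bits (m div 2)
        = (if odd n then One else Zero) # bits (n div 2)"
      using "1.prems" False bits.simps[of m] bits.simps[of n] by simp
    then have "m div 2 = n div 2" using "1.IH" False by blast
    moreover have "odd m = odd n" using eq by (simp split: if_splits)
    ultimately show ?thesis
      by (metis div_mult_mod_eq parity_cases)
  qed
qed

lemma terminated_eq:
  assumes "xs @ c # us = ys @ c # vs" "c \<notin> set xs" "c \<notin> set ys"
  shows "xs = ys \<and> us = vs"
  using assms
proof (induction xs arbitrary: ys)
  case Nil then show ?case by (cases ys) auto
next
  case (Cons x xs)
  obtain ys' where ys: "ys = x # ys'" using Cons.prems by (cases ys) auto
  have "xs = ys' \<and> us = vs"
    by (rule Cons.IH) (use Cons.prems ys in simp_all)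
  then show ?case using ys by simp
qed

lemma bits_not_in: "Comma \<notin> set (bits n)" "Semicolon \<notin> set (bits n)" "Hash \<notin> set (bits n)"
  using set_bits[of n] by auto

lemma bits_Comma_eq: "bits m @ Comma # us = bits n @ Comma # vs \<Longrightarrow> m = n \<and> us = vs"
  by (drule terminated_eq) (auto simp: bits_not_in dest: bits_inj)

lemma bits_Comma_neq: "bits m @ Comma # us \<noteq> Semicolon # vs" "bits m @ Comma # us \<noteq> Hash # vs"
  using bits_not_in[of m] by (simp_all add: append_eq_Cons_conv) auto

lemma enc_vertex_list_eq:
  "enc_vertex_list xs @ us = enc_vertex_list ys @ vs \<Longrightarrow> xs = ys \<and> us = vs"
proof (induction xs arbitrary: ys)
  case Nil then show ?case
    by (cases ys) (auto simp: enc_vertex_list_def bits_Comma_neq[symmetric])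
next
  case (Cons x xs)
  obtain y ys' where ys: "ys = y # ys'"
    using Cons.prems by (cases ys) (auto simp: enc_vertex_list_def bits_Comma_neq)
  from Cons.prems have "x = y \<and> enc_vertex_list xs @ us = enc_vertex_list ys' @ vs"
    unfolding ys by (auto simp: enc_vertex_list_def dest: bits_Comma_eq)
  with Cons.IH ys show ?case by blast
qed

lemma enc_vertex_list_neq: "enc_vertex_list xs @ us \<noteq> Hash # vs"
  by (cases xs) (auto simp: enc_vertex_list_def bits_Comma_neq)

lemma enc_edges_eq:
  "concat (map enc_vertex_list es) @ Hash # us = concat (map enc_vertex_list fs) @ Hash # vs
   \<Longrightarrow> es = fs \<and> us = vs"
proof (induction es arbitrary: fs)
  case Nil then show ?case
    by (cases fs) (auto simp: enc_vertex_list_neq[symmetric])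
next
  case (Cons e es)
  obtain f fs' where fs: "fs = f # fs'"
    using Cons.prems by (cases fs) (auto simp: enc_vertex_list_neq)
  from Cons.prems have "e = f \<and>
      concat (map enc_vertex_list es) @ Hash # us = concat (map enc_vertex_list fs') @ Hash # vs"
    unfolding fs by (intro enc_vertex_list_eq) simp
  with Cons.IH fs show ?case by blast
qed

lemma enc_hypergraph_eq:
  "enc_hypergraph xs es @ us = enc_hypergraph ys fs @ vs \<Longrightarrow> xs = ys \<and> es = fs \<and> us = vs"
  unfolding enc_hypergraph_def append_assoc append_Cons append_Nil
  using enc_vertex_list_eq enc_edges_eq by blast

lemma encodes_unique:
  assumes "encodes u G" "encodes u' G'" "u @ v = u' @ v'"
  shows "G = G' \<and> v = v'"
proof -
  obtain xs es ys fs where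
    u: "u = enc_hypergraph xs es" "set xs = verts G" "set (map set es) = edges G" and
    u': "u' = enc_hypergraph ys fs" "set ys = verts G'" "set (map set fs) = edges G'"
    using assms(1,2) unfolding encodes_def by blast
  have "xs = ys \<and> es = fs \<and> v = v'"
    using assms(3) unfolding u(1) u'(1) by (rule enc_hypergraph_eq)
  with u u' show ?thesis by (simp add: prod_eq_iff)
qed

lemma ex_solves_num_ind_sub: "\<exists>\<O>. solves \<O> (num_ind_sub \<H>)"
proof -
  have uniq: "y = y'" if "(x, y) \<in> num_ind_sub \<H>" "(x, y') \<in> num_ind_sub \<H>" for x y y'
    using that unfolding num_ind_sub_def
    by clarsimp (metis encodes_unique)
  show ?thesis
    unfolding solves_def
    by (rule exI[of _ "\<lambda>x. THE y. (x, y) \<in> num_ind_sub \<H>"]) (auto intro: uniq)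
qed

end

theory Submission imports Defs begin

text \<open>For a graph \<open>G\<close> let \<open>framed G\<close> arise by adding two new vertices \<open>a\<close>, \<open>b\<close>, the edges \<open>{a}\<close>,
  \<open>{b}\<close>, and an edge containing all vertices. The last edge alone is a fractional edge cover of
  weight 1. Any copy of \<open>framed G\<close> induced in \<open>framed G'\<close> contains \<open>a\<close> and \<open>b\<close> as they carry the
  only singleton edges; its vertex set is an edge containing both, hence is everything. So the
  number of copies is positive iff \<open>G\<close> and \<open>G'\<close> are isomorphic. On encodings, framing only requires
  fixed prefixes, a second copy of the vertex list, and appending one bit to every number (which
  makes room for the new vertices).\<close>

section \<open>The hypergraph family\<close>

lemma rho_star_le_one:
  assumes "hypergraph H" "verts H \<in> edges H"
  shows "rho_star H \<le> 1"
proof -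
  let ?V = "verts H" and ?C = "cover_edges H"
  let ?\<xi> = "\<lambda>e. if e = ?V then 1 else 0 :: real"
  have fin: "finite ?C"
    using assms finite_subset[of "edges H" "Pow ?V"]
    by (auto simp: cover_edges_def hypergraph_def)
  have V: "?V \<in> ?C" using assms by (simp add: cover_edges_def)
  have "fractional_edge_cover H ?\<xi>"
    using fin V by (auto simp: fractional_edge_cover_def sum.delta)
  moreover have "(\<Sum>e\<in>?C. ?\<xi> e) = 1" using fin V by (simp add: sum.delta)
  ultimately have "1 \<in> {\<Sum>e\<in>?C. \<xi> e | \<xi>. fractional_edge_cover H \<xi>}"
    by (smt (verit) mem_Collect_eq)
  \<comment> \<open>\<open>Inf\<close> on the reals is a lower bound only for sets bounded below;
    nonnegative weights provide the bound 0.\<close>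
  moreover have "bdd_below {\<Sum>e\<in>?C. \<xi> e | \<xi>. fractional_edge_cover H \<xi>}"
    by (rule bdd_belowI[of _ 0]) (auto simp: fractional_edge_cover_def intro!: sum_nonneg)
  ultimately show ?thesis unfolding rho_star_def by (rule cInf_lower)
qed

text \<open>\<open>inv_into\<close> undoes \<open>f\<close> only inside \<open>verts G\<close>;
  \<open>hypergraph G\<close> places every edge there.\<close>

lemma isomorphic_sym:
  assumes "hypergraph G" "isomorphic G H"
  shows "isomorphic H G"
proof -
  obtain f where f: "bij_betw f (verts G) (verts H)" "(\<lambda>e. f ` e) ` edges G = edges H"
    using assms unfolding isomorphic_def by blast
  let ?g = "inv_into (verts G) f"
  have "?g ` f ` e = e" if "e \<in> edges G" for e
    using that assms(1) f(1)
    by (intro inv_into_image_cancel) (auto simp: hypergraph_def bij_betw_def)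
  then have "(\<lambda>e. ?g ` e) ` edges H = edges G"
    by (simp add: f(2)[symmetric] image_image)
  then show ?thesis
    unfolding isomorphic_def using bij_betw_inv_into[OF f(1)] by blast
qed

text \<open>Finiteness matters because \<open>card\<close> is 0 on infinite sets.\<close>

lemma count_ind_sub_pos_iff:
  assumes "finite (verts G)"
  shows "0 < count_ind_sub H G \<longleftrightarrow> (\<exists>X \<subseteq> verts G. isomorphic (induced G X) H)"
proof -
  let ?S = "{F. (\<exists>X \<subseteq> verts G. F = induced G X) \<and> isomorphic F H}"
  have "finite ?S"
    by (rule finite_subset[of _ "induced G ` Pow (verts G)"]) (use assms in auto)
  then have "0 < count_ind_sub H G \<longleftrightarrow> ?S \<noteq> {}"
    unfolding count_ind_sub_def card_gt_0_iff by blast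
  then show ?thesis by blast
qed

section \<open>Renumbering the vertices\<close>

definition tag :: "nat \<Rightarrow> nat" where
  "tag v = v + 2 ^ length (bits v)"

text \<open>Position \<open>length (bits v)\<close> is the first one above the binary digits of
  \<open>v\<close>, so adding that power of 2 appends a new top bit.\<close>

lemma bits_tag: "bits (tag v) = bits v @ [One]"
proof (induction v rule: bits.induct)
  case (1 v)
  show ?case
  proof (cases "v = 0")
    case True
    then show ?thesis by (simp add: tag_def bits.simps[of 0] bits.simps[of 1] bits.simps[of "Suc 0"])
  next
    case False
    have len: "length (bits v) = Suc (length (bits (v div 2)))"
      using False by (subst bits.simps) simp
    have "tag v div 2 = tag (v div 2)" "odd (tag v) = odd v" "tag v \<noteq> 0"
      by (simp_all add: tag_def len False)
    then show ?thesis
      using 1 False bits.simps[of "tag v"] bits.simps[of v] by simp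
  qed
qed

lemma bits_0: "bits 0 = []" and bits_2: "bits 2 = [Zero, One]"
  by (simp_all add: bits.simps[of 0] bits.simps[of 2] bits.simps[of 1] bits.simps[of "Suc 0"])

lemma inj_tag: "inj tag"
  by (rule injI) (metis append_same_eq bits_inj bits_tag append1_eq_conv)

text \<open>The value 2 would require \<open>bits v = [Zero]\<close>, but the top bit of a nonzero
  number is \<open>One\<close>. The number 1 could not serve as a new vertex, being
  \<open>tag 0\<close>.\<close>

lemma tag_neq: "tag v \<noteq> 0" "tag v \<noteq> 2" "0 \<noteq> tag v" "2 \<noteq> tag v"
proof -
  show 0: "tag v \<noteq> 0" by (simp add: tag_def)
  have "bits v \<noteq> [Zero]"
    using bits.simps[of v] bits.simps[of "v div 2"] by (auto split: if_splits)
  then show 2: "tag v \<noteq> 2" using bits_tag[of v] by (auto simp: bits_2)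
  show "0 \<noteq> tag v" "2 \<noteq> tag v" using 0 2 by metis+
qed

text \<open>The two new vertices 0 and 2 lie outside the range of \<open>tag\<close>. Two are needed: with only one,
  the singleton edge and the full edge would coincide when the graph is empty.\<close>

definition framed_verts :: "nat hypergraph \<Rightarrow> nat set" where
  "framed_verts G = {0, 2} \<union> tag ` verts G"

definition framed :: "nat hypergraph \<Rightarrow> nat hypergraph" where
  "framed G =
     (framed_verts G, {{0}, {2}, framed_verts G} \<union> (\<lambda>e. tag ` e) ` edges G)"

lemma verts_framed: "verts (framed G) = framed_verts G"
  by (simp add: framed_def)

lemma hypergraph_framed:
  assumes "hypergraph G"
  shows "hypergraph (framed G)" "verts (framed G) \<in> edges (framed G)"
  using assms by (auto simp: hypergraph_def framed_def framed_verts_def)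

lemma isomorphic_framed:
  assumes "isomorphic G G'"
  shows "isomorphic (framed G) (framed G')"
proof -
  obtain f where f: "bij_betw f (verts G) (verts G')" "(\<lambda>e. f ` e) ` edges G = edges G'"
    using assms unfolding isomorphic_def by blast
  \<comment> \<open>\<open>f\<close> is transported along \<open>tag\<close>, and the two new
    vertices are fixed.\<close>
  define g where "g x = (if x \<in> {0, 2} then x else tag (f (inv tag x)))" for x
  have g: "g 0 = 0" "g 2 = 2" "g (tag v) = tag (f v)" for v
    by (simp_all add: g_def tag_neq inv_f_f[OF inj_tag])
  have gi: "g ` tag ` A = tag ` f ` A" for A by (simp add: image_image g)
  have "inj_on g (framed_verts G)"
    using f(1) by (auto simp: inj_on_def framed_verts_def g tag_neq inj_eq[OF inj_tag] bij_betw_def)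
  moreover have im: "g ` framed_verts G = framed_verts G'"
    using f(1) by (simp add: framed_verts_def image_Un g gi bij_betw_def)
  moreover have "(\<lambda>e. g ` e) ` edges (framed G) = edges (framed G')"
    by (simp add: framed_def image_Un g im gi image_image f(2)[symmetric])
  ultimately show ?thesis
    unfolding isomorphic_def by (intro exI[of _ g]) (simp add: bij_betw_def framed_def)
qed

text \<open>Once \<open>X\<close> is known to be everything, removing 0, 2 and all edges meeting
  them leaves the tagged graphs, and the given bijection restricts to an isomorphism between
  these.\<close>

lemma isomorphic_if_framed:
  assumes G: "graph G" and G': "graph G'"
    and "X \<subseteq> verts (framed G')" "isomorphic (induced (framed G') X) (framed G)"
  shows "isomorphic G' G"
proof -
  define E' where "E' = {e \<in> edges (framed G'). e \<subseteq> X}"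
  obtain f where f: "bij_betw f X (framed_verts G)" "(\<lambda>e. f ` e) ` E' = edges (framed G)"
    using assms(4) unfolding isomorphic_def E'_def by (auto simp: induced_def framed_def)
  have inj: "inj_on f X" and fX: "f ` X = framed_verts G" using f(1) by (auto simp: bij_betw_def)
  \<comment> \<open>A singleton edge can only come from \<open>{0}\<close> or \<open>{2}\<close>:
    edges of the graph \<open>G'\<close> have size 2, and the full edge contains both 0 and
    2.\<close>
  have preim: "\<exists>x. x \<in> {0, 2} \<and> x \<in> X \<and> f x = a" if a: "{a} \<in> edges (framed G)" for a
  proof -
    obtain e where e: "e \<in> E'" "f ` e = {a}" using a f(2) by (metis imageE)
    have "e \<subseteq> X" using e by (simp add: E'_def)
    then have "card e = 1" using card_image[of f e] inj inj_on_subset e(2) by fastforce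
    moreover have "card e = 2" if "e \<in> (\<lambda>e. tag ` e) ` edges G'"
      using that G' by (auto simp: graph_def card_image inj_on_subset[OF inj_tag])
    moreover have "e \<noteq> framed_verts G'"
    proof
      assume "e = framed_verts G'"
      then have "0 \<in> e" "2 \<in> e" by (auto simp: framed_verts_def)
      then show False using \<open>card e = 1\<close> by (auto simp: card_1_singleton_iff)
    qed
    ultimately have "e = {0} \<or> e = {2}" using e(1) by (auto simp: E'_def framed_def)
    then show ?thesis using e \<open>e \<subseteq> X\<close> by auto
  qed
  have "\<exists>x. x \<in> {0, 2} \<and> x \<in> X \<and> f x = 0" "\<exists>x. x \<in> {0, 2} \<and> x \<in> X \<and> f x = 2"
    by (rule preim; simp add: framed_def)+
  \<comment> \<open>The two preimages differ since their images do. As \<open>f\<close> may swap 0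
    and 2, only the set is known to be preserved.\<close>
  then have base: "0 \<in> X" "2 \<in> X" "f ` {0, 2} = {0, 2}" by auto
  \<comment> \<open>The edge mapped onto the full edge is \<open>X\<close> by injectivity, and an
    edge of \<open>framed G'\<close> containing 0 and 2 is the full one.\<close>
  obtain e where e: "e \<in> E'" "f ` e = framed_verts G"
    using f(2) hypergraph_framed(2)[of G] G
    by (metis (no_types, lifting) framed_def fst_conv graph_def imageE)
  have "e = X"
    using e inj fX inj_on_image_eq_iff[of f X e X] by (simp add: E'_def)
  then have "X \<in> edges (framed G')" using e by (simp add: E'_def)
  then have X: "X = framed_verts G'"
    using base(1,2) by (auto simp: framed_def tag_neq)
  have E': "E' = edges (framed G')"
    using G' hypergraph_framed(1)[of G']
    unfolding E'_def X graph_def hypergraph_def verts_framed by blast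
  have new: "f x \<in> {0, 2} \<longleftrightarrow> x \<in> {0, 2}" if "x \<in> X" for x
    using inj_on_image_mem_iff[OF inj that, of "{0, 2}", unfolded base(3)] base(1,2) by simp
  \<comment> \<open>The old edges are those avoiding 0 and 2, a property that \<open>f\<close>
    respects.\<close>
  have old: "edges (framed K) \<inter> {e. e \<inter> {0, 2} = {}} = (\<lambda>e. tag ` e) ` edges K" for K
    by (auto simp: framed_def framed_verts_def tag_neq)
  have oldv: "framed_verts K - {0, 2} = tag ` verts K" for K
    by (auto simp: framed_verts_def tag_neq)
  have disj: "f ` e \<inter> {0, 2} = {} \<longleftrightarrow> e \<inter> {0, 2} = {}" if "e \<subseteq> X" for e
    using new that by blast
  have "(\<lambda>e. f ` e) ` (E' \<inter> {e. e \<inter> {0, 2} = {}}) = edges (framed G) \<inter> {e. e \<inter> {0, 2} = {}}"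
    unfolding f(2)[symmetric] using disj by (auto simp: E'_def)
  then have im_edges: "(\<lambda>e. f ` e) ` (\<lambda>e. tag ` e) ` edges G' = (\<lambda>e. tag ` e) ` edges G"
    unfolding E' old .
  have "f ` (X - {0, 2}) = framed_verts G - {0, 2}"
    using inj_on_image_set_diff[OF inj, of X "{0, 2}"] base fX by auto
  then have im_verts: "f ` tag ` verts G' = tag ` verts G" unfolding X oldv .
  let ?g = "\<lambda>v. inv tag (f (tag v))"
  have inv_image_eq: "inv tag ` f ` tag ` A = ?g ` A" for A by (simp add: image_image)
  have "?g ` verts G' = verts G"
    unfolding inv_image_eq[symmetric] im_verts by (simp add: inj_tag image_image)
  moreover have "inj_on ?g (verts G')"
  proof (rule inj_onI)
    fix x y assume xy: "x \<in> verts G'" "y \<in> verts G'" "?g x = ?g y"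
    \<comment> \<open>\<open>inv tag\<close> is injective only on the range of \<open>tag\<close>,
      so both values must first be located there.\<close>
    then have "f (tag x) \<in> range tag" "f (tag y) \<in> range tag" using im_verts by blast+
    then have "f (tag x) = f (tag y)" using xy(3) by (metis f_inv_into_f)
    then show "x = y"
      using xy inj inj_tag by (auto simp: X framed_verts_def inj_on_def)
  qed
  moreover have "(\<lambda>e. ?g ` e) ` edges G' = (\<lambda>e. inv tag ` e) ` (\<lambda>e. f ` e) ` (\<lambda>e. tag ` e) ` edges G'"
    by (simp add: image_image)
  then have "(\<lambda>e. ?g ` e) ` edges G' = edges G"
    unfolding im_edges by (simp add: image_image inj_tag)
  ultimately show ?thesis
    unfolding isomorphic_def by (intro exI[of _ ?g]) (simp add: bij_betw_def)
qed

lemma count_framed_pos_iff: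
  assumes "graph G" "graph G'"
  shows "0 < count_ind_sub (framed G) (framed G') \<longleftrightarrow> isomorphic G G'"
proof
  have hyp: "hypergraph G" "hypergraph G'" "hypergraph (framed G')"
    using assms hypergraph_framed by (auto simp: graph_def)
  then have pos: "0 < count_ind_sub (framed G) (framed G') \<longleftrightarrow>
      (\<exists>X \<subseteq> verts (framed G'). isomorphic (induced (framed G') X) (framed G))"
    by (intro count_ind_sub_pos_iff) (simp add: hypergraph_def)
  show "isomorphic G G'" if "0 < count_ind_sub (framed G) (framed G')"
    using that pos isomorphic_if_framed[OF assms] isomorphic_sym[OF hyp(2)] by blast
  show "0 < count_ind_sub (framed G) (framed G')" if "isomorphic G G'"
  proof -
    have "isomorphic (framed G') (framed G)"
      using that assms isomorphic_framed isomorphic_sym[OF hyp(1)] by blast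
    moreover have "induced (framed G') (verts (framed G')) = framed G'"
      using hyp(3) by (auto simp: induced_def hypergraph_def prod_eq_iff)
    ultimately show ?thesis using pos by (metis order_refl)
  qed
qed

section \<open>Encoding the framed graph\<close>

text \<open>Every number in an encoding is followed by a comma, so a \<open>One\<close> before each
  comma applies \<open>tag\<close> to all numbers in a single pass, without decoding them.\<close>

definition mark_commas :: "word \<Rightarrow> word" where
  "mark_commas w = concat (map (\<lambda>c. if c = Comma then [One, Comma] else [c]) w)"

lemma mark_commas_simps [simp]:
  "mark_commas [] = []"
  "mark_commas (c # w) = (if c = Comma then [One, Comma] else [c]) @ mark_commas w"
  "mark_commas (v @ w) = mark_commas v @ mark_commas w"
  by (simp_all add: mark_commas_def)

lemma mark_commas_bits [simp]: "mark_commas (bits v) = bits v"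
proof -
  have "mark_commas w = w" if "Comma \<notin> set w" for w
    using that by (induction w) auto
  then show ?thesis using bits_not_in by blast
qed

lemma mark_commas_enc_vertex_list:
  "mark_commas (enc_vertex_list vs) = enc_vertex_list (map tag vs)"
  by (induction vs) (simp_all add: enc_vertex_list_def bits_tag)

lemma mark_commas_enc_edges:
  "mark_commas (concat (map enc_vertex_list es))
    = concat (map enc_vertex_list (map (map tag) es))"
  by (induction es) (simp_all add: mark_commas_enc_vertex_list)

text \<open>Opens a vertex list with 0, which is the empty word, and 2.\<close>

definition prefix1 :: word where
  "prefix1 = [Comma, Zero, One, Comma]"

text \<open>The complete edges \<open>[0]\<close> and \<open>[2]\<close>, then the beginning of the
  full edge.\<close>

definition prefix2 :: word where
  "prefix2 = [Comma, Semicolon, Zero, One, Comma, Semicolon] @ prefix1"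

text \<open>In the last block the vertex list completes the full edge begun by
  \<open>prefix2\<close>; the old edges and the final \<open>Hash\<close> follow.\<close>

definition frame_enc :: "nat list \<Rightarrow> nat list list \<Rightarrow> word" where
  "frame_enc vs es = prefix1 @ mark_commas (enc_vertex_list vs) @
     prefix2 @ mark_commas (enc_hypergraph vs es)"

lemma frame_enc_eq:
  "frame_enc vs es = enc_hypergraph (0 # 2 # map tag vs)
     ([0] # [2] # (0 # 2 # map tag vs) # map (map tag) es)"
  unfolding frame_enc_def enc_hypergraph_def mark_commas_simps(3)
    mark_commas_enc_vertex_list mark_commas_enc_edges
  by (simp add: prefix1_def prefix2_def enc_vertex_list_def bits_0 bits_2)

lemma encodes_framed:
  assumes "distinct vs" "set vs = verts G" "\<forall>e\<in>set es. distinct e"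
    "distinct (map set es)" "set (map set es) = edges G"
  shows "encodes (frame_enc vs es) (framed G)"
proof -
  let ?vs = "0 # 2 # map tag vs"
  let ?es = "[0] # [2] # ?vs # map (map tag) es"
  have inj: "inj_on tag A" for A using inj_tag inj_on_subset by blast
  have sets: "map set (map (map tag) es) = map (\<lambda>e. tag ` e) (map set es)" by simp
  have "inj_on (\<lambda>e. tag ` e) A" for A
    using inj_image_eq_iff[OF inj_tag] by (auto simp: inj_on_def)
  then have dist: "distinct (map set (map (map tag) es))"
    unfolding sets using assms(4) distinct_map by blast
  \<comment> \<open>Each of the three added edges contains 0 or 2, which no tagged edge
    does.\<close>
  have new: "A \<notin> set (map set (map (map tag) es))" if "0 \<in> A \<or> 2 \<in> A" for A
    using that by (auto simp: tag_neq)
  have "distinct ?vs"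
    using assms(1) inj by (auto simp: distinct_map tag_neq)
  moreover have "\<forall>e\<in>set ?es. distinct e"
    using assms(3) \<open>distinct ?vs\<close> inj by (auto simp: distinct_map)
  moreover have "distinct (map set ?es)"
    using dist new[of "{0}"] new[of "{2}"] new[of "set ?vs"] by (auto simp: doubleton_eq_iff)
  moreover have "set ?vs = verts (framed G)"
    using assms(2) by (auto simp: framed_def framed_verts_def)
  moreover have "set (map set ?es) = edges (framed G)"
    unfolding framed_def framed_verts_def assms(5)[symmetric] assms(2)[symmetric]
    by (auto simp: image_image)
  ultimately show ?thesis
    unfolding encodes_def frame_enc_eq by blast
qed

section \<open>The machine\<close>

text \<open>On a comma the input head stays, so that state \<open>Suc q\<close> reads this comma
  again and writes it. \<open>d\<close> is the input move at the stop letter: -1 to begin the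
  rewind, 1 to leave the graph.\<close>

definition copy_action :: "letter \<Rightarrow> nat \<Rightarrow> nat \<Rightarrow> int \<Rightarrow> symbol \<Rightarrow> nat \<times> symbol \<times> int" where
  "copy_action stop q q' d s =
     (if s = Letter Comma then (Suc q, Letter One, 0)
      else if s = Letter stop then (q', s, d)
      else (q, s, 1))"

text \<open>States 0--3 and 7--16 emit \<open>prefix1\<close> and \<open>prefix2\<close>; states 4 and 17 copy up to and
  including a stop letter, states 5 and 18 write the comma after its marker; state 6 rewinds
  the input head to the beginning of the vertex list. State 0 is entered once per encoded graph and
  once more on the blank after the input, and state 19 is the query. The result is the new state,
  the symbol written on the oracle tape, and the moves of the input and the oracle head.\<close>

definition framing_action :: "nat \<Rightarrow> symbol \<Rightarrow> symbol \<Rightarrow> nat \<times> symbol \<times> int \<times> int" where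
  "framing_action q s t =
     (let emit = (\<lambda>(q', x, d). (q', x, d, 1)) in
      if q = 0 \<and> s = Blank then (19, t, 0, 0)
      else if q < 4 then emit (Suc q, Letter (prefix1 ! q), 0)
      else if q = 4 then emit (copy_action Semicolon 4 6 (-1) s)
      else if q = 5 then emit (4, s, 1)
      else if q = 6 then
        (if s = Blank \<or> s = Letter Hash then (7, t, 1, 0) else (6, t, -1, 0))
      else if q < 17 then emit (Suc q, Letter (prefix2 ! (q - 7)), 0)
      else if q = 17 then emit (copy_action Hash 17 0 1 s)
      else if q = 18 then emit (17, s, 1)
      else (if t = Blank then 22 else 21, t, 0, 0))"

definition framing_machine :: machine where
  "framing_machine = \<lparr>num_states = 23, num_aux = 0, num_tapes = 2, start_state = 0,
     query_state = 19, resume_state = 20, accept_state = 21, reject_state = 22,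
     transition = (\<lambda>q ss. case framing_action q (ss ! 0) (ss ! 1) of
       (q', x, d, e) \<Rightarrow> (q', [(ss ! 0, d), (x, e)]))\<rparr>"

lemma framing_action_range:
  assumes "framing_action q s t = (q', x, d, e)"
  shows "q' < 23 \<and> x \<in> {s, t} \<union> range Letter \<and> d \<in> {-1, 0, 1} \<and> e \<in> {-1, 0, 1}"
  using assms
  by (simp add: framing_action_def copy_action_def Let_def split: if_split_asm) auto

lemma oracle_machine_framing: "oracle_machine framing_machine"
proof -
  have len: "\<exists>a b. ss = [a, b]" if "length ss = 2" for ss :: "symbol list"
    using that by (auto simp: numeral_2_eq_2 length_Suc_conv)
  show ?thesis
    unfolding oracle_machine_def framing_machine_def
    by (auto dest!: len framing_action_range simp: tape_alphabet_def split: prod.splits)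
qed

section \<open>Timed runs and tape contents\<close>

definition reaches :: "(word \<Rightarrow> word) \<Rightarrow> nat \<Rightarrow> config \<Rightarrow> config \<Rightarrow> bool" where
  "reaches \<O> n c c' \<longleftrightarrow> (\<exists>m\<le>n. (step \<O> framing_machine ^^ m) c = c')"

lemma reaches_trans:
  assumes "reaches \<O> m a b" "reaches \<O> n b c"
  shows "reaches \<O> (m + n) a c"
proof -
  obtain i j where "i \<le> m" "j \<le> n" "(step \<O> framing_machine ^^ i) a = b"
    "(step \<O> framing_machine ^^ j) b = c"
    using assms unfolding reaches_def by blast
  then have "(step \<O> framing_machine ^^ (j + i)) a = c" "j + i \<le> m + n"
    by (simp_all add: funpow_add)
  then show ?thesis unfolding reaches_def by blast
qed

lemma reaches_mono: "reaches \<O> m a b \<Longrightarrow> m \<le> n \<Longrightarrow> reaches \<O> n a b"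
  unfolding reaches_def using order_trans by blast

lemma reaches_refl: "reaches \<O> n a a"
  unfolding reaches_def by (rule exI[of _ 0]) simp

lemma reaches_step: "step \<O> framing_machine a = b \<Longrightarrow> reaches \<O> 1 a b"
  unfolding reaches_def by (rule exI[of _ 1]) simp

abbreviation cell :: "word \<Rightarrow> int \<Rightarrow> symbol" where
  "cell w \<equiv> fst (tape_of w)"

lemma cell_eq:
  "cell w i = (if 0 \<le> i \<and> i < int (length w) then Letter (w ! nat i) else Blank)"
  by (simp add: tape_of_def)

lemma cell_append [simp]: "cell (u @ c # v) (int (length u)) = Letter c"
  by (simp add: cell_eq)

lemma cell_length [simp]: "cell w (int (length w)) = Blank"
  by (simp add: cell_eq)

lemma cell_snoc: "(cell w)(int (length w) := Letter c) = cell (w @ [c])"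
  by (rule ext) (auto simp: cell_eq nth_append)

lemma word_on_cell: "word_on (cell w, h) = w"
proof -
  have "(LEAST n. cell w (int n) \<notin> range Letter) = length w"
    by (rule Least_equality) (auto simp: cell_eq not_less[symmetric])
  moreover have "map (\<lambda>i. the_inv Letter (cell w (int i))) [0..<length w] = w"
    by (rule nth_equalityI) (simp_all add: cell_eq the_inv_f_f inj_def)
  ultimately show ?thesis by (simp add: word_on_def)
qed

text \<open>The oracle head stands on the first blank after the output, so writing a letter appends
  it and the symbol read there is always \<open>Blank\<close>.\<close>

definition copy_config :: "nat \<Rightarrow> word \<Rightarrow> int \<Rightarrow> word \<Rightarrow> config" where
  "copy_config q w k out = (q, [(cell w, k), (cell out, int (length out))])"

text \<open>\<open>q < 19\<close> excludes the query and halting states, in which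
  \<open>step\<close> ignores the transition function.\<close>

lemma step_emit:
  assumes "framing_action q (cell w k) Blank = (q', Letter c, d, 1)" "q < 19"
  shows "reaches \<O> 1 (copy_config q w k out) (copy_config q' w (k + d) (out @ [c]))"
  using assms
  by (intro reaches_step) (simp add: copy_config_def framing_machine_def cell_snoc)

lemma step_silent:
  assumes "framing_action q (cell w k) Blank = (q', Blank, d, 0)" "q < 19"
  shows "reaches \<O> 1 (copy_config q w k out) (copy_config q' w (k + d) out)"
proof -
  have "(cell out)(int (length out) := Blank) = cell out"
    by (metis cell_length fun_upd_triv)
  then show ?thesis
    using assms by (intro reaches_step) (simp add: copy_config_def framing_machine_def)
qed

text \<open>The state counts the letters of a fixed word while the input head rests.\<close>

lemma emit_word:
  assumes "\<And>i. i < length v \<Longrightarrow>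
      framing_action (q + i) (cell w k) Blank = (Suc (q + i), Letter (v ! i), 0, 1)"
    and "q + length v \<le> 19"
  shows "reaches \<O> (length v) (copy_config q w k out) (copy_config (q + length v) w k (out @ v))"
  using assms
proof (induction v arbitrary: q out)
  case Nil
  then show ?case by (simp add: reaches_refl)
next
  case (Cons c v)
  have "reaches \<O> 1 (copy_config q w k out) (copy_config (Suc q) w (k + 0) (out @ [c]))"
    using Cons.prems(1)[of 0] Cons.prems(2) by (intro step_emit) auto
  moreover have "reaches \<O> (length v) (copy_config (Suc q) w k (out @ [c]))
      (copy_config (Suc q + length v) w k ((out @ [c]) @ v))"
    using Cons.prems(1)[of "Suc _"] Cons.prems(2) by (intro Cons.IH) auto
  ultimately show ?case using reaches_trans by fastforce
qed

text \<open>The induction moves each letter read from \<open>v\<close> to \<open>u\<close>. A comma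
  costs two steps and any other letter one, hence the factor 2.\<close>

lemma copy_word:
  assumes "(q, stop) = (4, Semicolon) \<or> (q, stop) = (17, Hash)" "stop \<notin> set v"
  shows "reaches \<O> (2 * length v) (copy_config q (u @ v @ x) (int (length u)) out)
    (copy_config q (u @ v @ x) (int (length (u @ v))) (out @ mark_commas v))"
  using assms(2)
proof (induction v arbitrary: u out)
  case Nil
  then show ?case by (simp add: reaches_refl)
next
  case (Cons c v)
  let ?w = "u @ (c # v) @ x"
  let ?k = "int (length u)"
  have "reaches \<O> 2 (copy_config q ?w ?k out)
      (copy_config q ?w (?k + 1) (out @ mark_commas [c]))"
  proof (cases "c = Comma")
    case True
    have "reaches \<O> 1 (copy_config q ?w ?k out) (copy_config (Suc q) ?w (?k + 0) (out @ [One]))"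
      using assms(1) True
      by (intro step_emit) (auto simp: framing_action_def copy_action_def)
    moreover have "reaches \<O> 1 (copy_config (Suc q) ?w ?k (out @ [One]))
        (copy_config q ?w (?k + 1) ((out @ [One]) @ [Comma]))"
      using assms(1) True by (intro step_emit) (auto simp: framing_action_def)
    ultimately show ?thesis using True reaches_trans[of \<O> 1 _ _ 1] by (simp add: numeral_2_eq_2)
  next
    case False
    have "reaches \<O> 1 (copy_config q ?w ?k out) (copy_config q ?w (?k + 1) (out @ [c]))"
      using assms(1) False Cons.prems
      by (intro step_emit) (auto simp: framing_action_def copy_action_def)
    then show ?thesis using False reaches_mono[of \<O> 1 _ _ 2] by simp
  qed
  moreover have "reaches \<O> (2 * length v)
      (copy_config q ((u @ [c]) @ v @ x) (int (length (u @ [c]))) (out @ mark_commas [c]))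
      (copy_config q ((u @ [c]) @ v @ x) (int (length ((u @ [c]) @ v)))
        ((out @ mark_commas [c]) @ mark_commas v))"
    using Cons.prems by (intro Cons.IH) simp
  ultimately show ?case
    using reaches_trans[of \<O> 2 _ _ "2 * length v"] by (simp add: add.commute)
qed

text \<open>\<open>b\<close> is the cell of the left sentinel. The extra step turns the head around
  there.\<close>

lemma rewind:
  assumes "cell w b \<in> {Blank, Letter Hash}"
    and "\<And>i. i < n \<Longrightarrow> cell w (b + 1 + int i) \<notin> {Blank, Letter Hash}"
  shows "reaches \<O> (Suc n) (copy_config 6 w (b + int n) out) (copy_config 7 w (b + 1) out)"
  using assms(2)
proof (induction n)
  case 0
  have "reaches \<O> 1 (copy_config 6 w b out) (copy_config 7 w (b + 1) out)"
    using assms(1) by (intro step_silent) (auto simp: framing_action_def)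
  then show ?case by simp
next
  case (Suc n)
  have "reaches \<O> 1 (copy_config 6 w (b + int (Suc n)) out)
      (copy_config 6 w (b + int (Suc n) + -1) out)"
    using Suc.prems[of n] by (intro step_silent) (auto simp: framing_action_def algebra_simps)
  moreover have "reaches \<O> (Suc n) (copy_config 6 w (b + int n) out) (copy_config 7 w (b + 1) out)"
    using Suc.prems by (intro Suc.IH) auto
  ultimately show ?case using reaches_trans by fastforce
qed

text \<open>The condition on \<open>x\<close> provides the sentinel for the rewind: the blank before
  the input or the \<open>Hash\<close> of the preceding graph. Ending in state 0 allows a second
  round.\<close>

lemma frame_one:
  assumes "x = [] \<or> last x = Hash" and u: "u = enc_hypergraph vs es"
  shows "reaches \<O> (5 * length u + 17) (copy_config 0 (x @ u @ y) (int (length x)) out)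
    (copy_config 0 (x @ u @ y) (int (length (x @ u))) (out @ frame_enc vs es))"
proof -
  let ?w = "x @ u @ y"
  let ?R = "\<lambda>n q k out q' k' out'.
    reaches \<O> n (copy_config q ?w k out) (copy_config q' ?w k' out')"
  define v where "v = concat (map (\<lambda>v. bits v @ [Comma]) vs)"
  define e where "e = concat (map enc_vertex_list es)"
  define k where "k = int (length x)"
  have vlist: "enc_vertex_list vs = v @ [Semicolon]" by (simp add: enc_vertex_list_def v_def)
  have u1: "u = v @ Semicolon # e @ [Hash]" by (simp add: u enc_hypergraph_def vlist e_def)
  define u0 where "u0 = v @ Semicolon # e"
  have u0: "u = u0 @ [Hash]" by (simp add: u1 u0_def)
  have v: "set v \<subseteq> {Zero, One, Comma}" unfolding v_def by (auto dest!: set_bits[THEN subsetD])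
  have hash_list: "Hash \<notin> set (enc_vertex_list l)" for l
    using bits_not_in(3) by (auto simp: enc_vertex_list_def)
  then have hash: "Hash \<notin> set u0" using v by (auto simp: u0_def e_def)
  let ?o1 = "out @ prefix1"
  let ?o2 = "?o1 @ mark_commas v"
  let ?o3 = "?o2 @ [Semicolon]"
  let ?o4 = "?o3 @ prefix2"
  let ?o5 = "?o4 @ mark_commas u0"
  have "cell ?w k \<noteq> Blank" by (simp add: k_def cell_eq u1)
  then have s1: "?R (length prefix1) 0 k out (0 + length prefix1) k ?o1"
    by (intro emit_word) (auto simp: framing_action_def prefix1_def)
  have s2: "?R (2 * length v) 4 k ?o1 4 (k + int (length v)) ?o2"
    using copy_word[of 4 Semicolon v \<O> x "Semicolon # e @ [Hash] @ y" ?o1] v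
    by (auto simp: u1 k_def)
  have "cell ?w (k + int (length v)) = Letter Semicolon"
    using cell_append[of "x @ v"] by (simp add: u1 k_def)
  \<comment> \<open>The move left from the semicolon reaches the start of the rewind; for empty
    \<open>v\<close> this is already the sentinel.\<close>
  then have s3: "?R 1 4 (k + int (length v)) ?o2 6 (k + int (length v) + -1) ?o3"
    by (intro step_emit) (auto simp: framing_action_def copy_action_def)
  have "cell ?w (k - 1) \<in> {Blank, Letter Hash}"
    using assms(1) by (cases x rule: rev_cases) (auto simp: cell_eq k_def nth_append)
  moreover have "cell ?w (k - 1 + 1 + int i) \<notin> {Blank, Letter Hash}" if "i < length v" for i
    using that subsetD[OF v nth_mem[OF that]] by (auto simp: cell_eq k_def nth_append u1 nat_add_distrib)
  ultimately have s4: "?R (Suc (length v)) 6 (k - 1 + int (length v)) ?o3 7 (k - 1 + 1) ?o3"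
    by (rule rewind)
  have s5: "?R (length prefix2) 7 k ?o3 (7 + length prefix2) k ?o4"
    by (intro emit_word) (auto simp: framing_action_def prefix2_def prefix1_def)
  have s6: "?R (2 * length u0) 17 k ?o4 17 (k + int (length u0)) ?o5"
    using copy_word[of 17 Hash u0 \<O> x "[Hash] @ y" ?o4] hash by (simp add: u0 k_def)
  have "cell ?w (k + int (length u0)) = Letter Hash"
    using cell_append[of "x @ u0"] by (simp add: u0 k_def)
  then have s7: "?R 1 17 (k + int (length u0)) ?o5 0 (k + int (length u0) + 1) (?o5 @ [Hash])"
    by (intro step_emit) (auto simp: framing_action_def copy_action_def)
  have len: "length prefix1 = 4" "length prefix2 = 10" by (simp_all add: prefix1_def prefix2_def)
  have out: "?o5 @ [Hash] = out @ frame_enc vs es"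
    unfolding frame_enc_def vlist u[symmetric] u0 by simp
  have end_pos: "k + int (length u0) + 1 = int (length (x @ u))" by (simp add: k_def u0)
  have "?R (4 + 2 * length v) 0 k out 4 (k + int (length v)) ?o2"
    using reaches_trans[OF s1[unfolded len add_0] s2] .
  note reaches_trans[OF this s3]
  moreover have "?R (Suc (length v)) 6 (k + int (length v) + -1) ?o3 7 k ?o3"
    using s4 by (simp add: algebra_simps)
  ultimately have "?R (4 + 2 * length v + 1 + Suc (length v)) 0 k out 7 k ?o3"
    by (rule reaches_trans)
  moreover have "?R 10 7 k ?o3 17 k ?o4" using s5 by (simp add: len)
  ultimately have "?R (4 + 2 * length v + 1 + Suc (length v) + 10) 0 k out 17 k ?o4"
    by (rule reaches_trans)
  \<comment> \<open>The phases take at most \<open>17 + 3 * length v + 2 * length u0\<close> steps,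
    and both words are shorter than \<open>u\<close>.\<close>
  note reaches_trans[OF reaches_trans[OF this s6] s7]
  then show ?thesis
    unfolding out end_pos unfolding k_def by (rule reaches_mono) (simp add: u1 u0_def)
qed

section \<open>Query, decision and time bound\<close>

lemma query_and_answer:
  "reaches \<O> 3 (copy_config 0 w (int (length w)) out)
    (if \<O> out = [] then 22 else 21, [(cell w, int (length w)), tape_of (\<O> out)])"
proof -
  let ?T = "tape_of (\<O> out)"
  have 1: "reaches \<O> 1 (copy_config 0 w (int (length w)) out)
      (copy_config 19 w (int (length w) + 0) out)"
    by (intro step_silent) (simp_all add: framing_action_def)
  have 2: "reaches \<O> 1 (copy_config 19 w (int (length w)) out)
      (20, [(cell w, int (length w)), ?T])"
    by (intro reaches_step) (simp add: copy_config_def framing_machine_def word_on_cell)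
  \<comment> \<open>A blank first cell means the empty answer, which is the code of 0.\<close>
  have 3: "reaches \<O> 1 (20, [(cell w, int (length w)), ?T])
      (if \<O> out = [] then 22 else 21, [(cell w, int (length w)), ?T])"
    by (intro reaches_step) (auto simp: framing_machine_def framing_action_def tape_of_def)
  from reaches_trans[OF reaches_trans[OF 1[unfolded add_0_right] 2] 3]
  show ?thesis by (rule reaches_mono) simp
qed

text \<open>\<open>decides_within\<close> inspects the state after exactly \<open>n\<close> steps;
  halting configurations are fixed by \<open>step\<close>, so an earlier halt persists.\<close>

lemma decides_within_if_reaches:
  assumes "reaches \<O> n (initial framing_machine w) (if b then 21 else 22, Ts)"
  shows "decides_within \<O> framing_machine w b n"
proof -
  let ?s = "step \<O> framing_machine"
  let ?c = "(if b then 21 else 22, Ts) :: config"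
  obtain m where m: "m \<le> n" "(?s ^^ m) (initial framing_machine w) = ?c"
    using assms unfolding reaches_def by blast
  have "(?s ^^ j) ?c = ?c" for j
    by (induction j) (auto simp: framing_machine_def)
  then have "(?s ^^ ((n - m) + m)) (initial framing_machine w) = ?c"
    by (simp only: funpow_add o_apply m(2))
  then show ?thesis using m(1) by (simp add: decides_within_def framing_machine_def)
qed

text \<open>Two framing rounds and three final steps give the constant
  \<open>17 + 17 + 3 = 37\<close>.\<close>

lemma decides_framing:
  assumes "u = enc_hypergraph vs es" "v = enc_hypergraph vs' es'"
    and answer: "\<O> (frame_enc vs es @ frame_enc vs' es') \<noteq> [] \<longleftrightarrow> b"
  shows "decides_within \<O> framing_machine (u @ v) b (5 * length (u @ v) + 37)"
proof (rule decides_within_if_reaches)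
  let ?w = "u @ v"
  let ?out = "frame_enc vs es @ frame_enc vs' es'"
  have init: "initial framing_machine ?w = copy_config 0 ?w 0 []"
    by (simp add: initial_def framing_machine_def copy_config_def tape_of_def)
  have "reaches \<O> (5 * length u + 17) (copy_config 0 ?w 0 [])
      (copy_config 0 ?w (int (length u)) (frame_enc vs es))"
    using frame_one[of "[]" u vs es \<O> v "[]"] assms(1) by simp
  moreover have "reaches \<O> (5 * length v + 17)
      (copy_config 0 ?w (int (length u)) (frame_enc vs es)) (copy_config 0 ?w (int (length ?w)) ?out)"
    using frame_one[of u v vs' es' \<O> "[]" "frame_enc vs es"] assms(1,2)
    by (simp add: enc_hypergraph_def)
  ultimately have "reaches \<O> (5 * length u + 17 + (5 * length v + 17)) (copy_config 0 ?w 0 [])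
      (copy_config 0 ?w (int (length ?w)) ?out)"
    by (rule reaches_trans)
  from reaches_trans[OF this query_and_answer]
  have "reaches \<O> (5 * length ?w + 37) (copy_config 0 ?w 0 [])
      (if \<O> ?out = [] then 22 else 21, [(cell ?w, int (length ?w)), tape_of (\<O> ?out)])"
    by (rule reaches_mono) simp
  moreover have "(if \<O> ?out = [] then 22 else 21) = (if b then 21 else 22 :: nat)"
    using answer by auto
  ultimately show "reaches \<O> (5 * length ?w + 37) (initial framing_machine ?w)
      (if b then 21 else 22, [(cell ?w, int (length ?w)), tape_of (\<O> ?out)])"
    unfolding init by simp
qed

theorem theorem1p3:
  "\<exists>\<H> :: nat hypergraph set.
     (\<forall>H\<in>\<H>. hypergraph H) \<and> rho_star_family \<H> < \<infinity> \<and>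
     poly_time_reducible graph_isomorphism (num_ind_sub \<H>)"
proof -
  define \<H> :: "nat hypergraph set" where "\<H> = {H. hypergraph H \<and> verts H \<in> edges H}"
  have "rho_star_family \<H> \<le> 1"
    unfolding rho_star_family_def \<H>_def by (rule SUP_least) (simp add: rho_star_le_one)
  then have "rho_star_family \<H> < \<infinity>" by (rule order_le_less_trans) simp
  moreover have "decides_within \<O> framing_machine w b (poly [:37, 5:] (length w))"
    if \<O>: "solves \<O> (num_ind_sub \<H>)" and w: "(w, b) \<in> graph_isomorphism" for \<O> w b
  proof -
    obtain u v G G' where G: "graph G" "graph G'" "encodes u G" "encodes v G'"
      and wb: "w = u @ v" "b \<longleftrightarrow> isomorphic G G'"
      using w unfolding graph_isomorphism_def by blast
    obtain vs es where u: "u = enc_hypergraph vs es" "encodes (frame_enc vs es) (framed G)"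
      using G(3) encodes_framed unfolding encodes_def[of u] by blast
    obtain vs' es' where v: "v = enc_hypergraph vs' es'" "encodes (frame_enc vs' es') (framed G')"
      using G(4) encodes_framed unfolding encodes_def[of v] by blast
    have "framed G \<in> \<H>" "hypergraph (framed G')"
      using G(1,2) by (simp_all add: hypergraph_framed graph_def \<H>_def)
    have "(frame_enc vs es @ frame_enc vs' es', bits (count_ind_sub (framed G) (framed G')))
        \<in> num_ind_sub \<H>"
      unfolding num_ind_sub_def mem_Collect_eq by (intro exI conjI) (rule refl | fact)+
    from bspec[OF \<O>[unfolded solves_def] this]
    have "\<O> (frame_enc vs es @ frame_enc vs' es') = bits (count_ind_sub (framed G) (framed G'))"
      by simp
    moreover have "bits n \<noteq> [] \<longleftrightarrow> 0 < n" for n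
      by (subst bits.simps) simp
    ultimately have "\<O> (frame_enc vs es @ frame_enc vs' es') \<noteq> [] \<longleftrightarrow> b"
      using count_framed_pos_iff[OF G(1,2)] wb(2) by simp
    from decides_framing[where \<O> = \<O>, OF u(1) v(1) this] show ?thesis
      by (simp add: wb(1) algebra_simps)
  qed
  ultimately show ?thesis
    using oracle_machine_framing unfolding poly_time_reducible_def
    by (intro exI[of _ \<H>] conjI exI[of _ framing_machine] exI[of _ "[:37, 5:]"])
      (auto simp: \<H>_def)
qed

end
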